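(* Let $P=(X,\prec)$ be a finite poset of width $w$. Then $\Omega(P,t)/t^w$ is weakly increasing as a function of $t\in\{1,2,3,\dots\}$.
   Context: The width of $P$ is the maximum size of an antichain (a set of pairwise incomparable elements). $\Omega(P,t)$ is the number of maps $g:X\to[t]$ with $g(x)\le g(y)$ whenever $x\prec y$. *)

theory Defs
  imports Complex_Main "HOL-Library.FuncSet"
begin

definition strict_poset :: "'a set \<Rightarrow> ('a \<Rightarrow> 'a \<Rightarrow> bool) \<Rightarrow> bool" where
  "strict_poset X prec \<longleftrightarrow> irreflp_on X prec \<and> transp_on X prec"

definition antichain :: "'a set \<Rightarrow> ('a \<Rightarrow> 'a \<Rightarrow> bool) \<Rightarrow> 'a set \<Rightarrow> bool" where
  "antichain X prec A \<longleftrightarrow> A \<subseteq> X \<and> pairwise (\<lambda>x y. \<not> prec x y \<and> \<not> prec y x) A"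

text \<open>For finite \<open>X\<close> the maximum ranges over a finite set, nonempty because the
  empty set is an antichain; the empty poset has width 0.\<close>

definition width :: "'a set \<Rightarrow> ('a \<Rightarrow> 'a \<Rightarrow> bool) \<Rightarrow> nat" where
  "width X prec = Max (card ` {A. antichain X prec A})"

text \<open>The extensional function space makes each map \<open>X \<rightarrow> {1..t}\<close> count once,
  independently of values outside \<open>X\<close>.\<close>

definition order_preserving_maps ::
    "'a set \<Rightarrow> ('a \<Rightarrow> 'a \<Rightarrow> bool) \<Rightarrow> nat \<Rightarrow> ('a \<Rightarrow> nat) set" where
  "order_preserving_maps X prec t =
     {g \<in> X \<rightarrow>\<^sub>E {1..t}. monotone_on X prec (\<le>) g}"

definition Omega :: "'a set \<Rightarrow> ('a \<Rightarrow> 'a \<Rightarrow> bool) \<Rightarrow> nat \<Rightarrow> nat" where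
  "Omega X prec t = card (order_preserving_maps X prec t)"

end

theory Submission
  imports Defs
begin

text \<open>
  Fix a maximum antichain \<open>A\<close>. For \<open>S \<subseteq> A\<close>, adding 1 on the up-closure of \<open>S\<close> maps order-preserving
  maps into \<open>{1..t}\<close> injectively to order-preserving maps into \<open>{1..t+1}\<close>, and among the elements of
  \<open>A\<close> raises exactly those in \<open>S\<close>. Give the pair \<open>(g, S)\<close> the weight
  \<open>\<Prod>a\<in>S. g a\<close> times \<open>\<Prod>a\<in>A - S. t + 1 - g a\<close>. For fixed \<open>g\<close> these weights sum to
  \<open>(t + 1) ^ w\<close>; expressed through the image \<open>h\<close>, the factors become \<open>h a - 1\<close> and \<open>t + 1 - h a\<close>,
  so for fixed \<open>h\<close> they sum to at most \<open>t ^ w\<close>.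
\<close>

lemma exists_antichain_card_width:
  assumes "finite X"
  obtains A where "antichain X prec A" and "card A = width X prec"
proof -
  have "{A. antichain X prec A} \<subseteq> Pow X"
    by (auto simp: antichain_def)
  then have "finite {A. antichain X prec A}"
    using assms finite_subset by blast
  moreover have "antichain X prec {}"
    by (simp add: antichain_def)
  ultimately have "width X prec \<in> card ` {A. antichain X prec A}"
    unfolding width_def by (intro Max_in) auto
  then show ?thesis
    using that by auto
qed

lemma finite_order_preserving_maps:
  "finite X \<Longrightarrow> finite (order_preserving_maps X prec t)"
  unfolding order_preserving_maps_def
  by (rule finite_subset[OF _ finite_PiE[of X "\<lambda>_. {1..t}"]]) auto

definition up_closure :: "'a set \<Rightarrow> ('a \<Rightarrow> 'a \<Rightarrow> bool) \<Rightarrow> 'a set \<Rightarrow> 'a set" where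
  "up_closure X prec S = {x \<in> X. \<exists>s\<in>S. s = x \<or> prec s x}"

text \<open>Restricting to \<open>X\<close> keeps the result extensional, so that it can lie in the
  function space over which \<open>Omega\<close> counts.\<close>

definition shift_on :: "'a set \<Rightarrow> 'a set \<Rightarrow> ('a \<Rightarrow> nat) \<Rightarrow> 'a \<Rightarrow> nat" where
  "shift_on X V g = (\<lambda>x\<in>X. g x + of_bool (x \<in> V))"

text \<open>The increment at \<open>x\<close> depends on \<open>V\<close> and \<open>x\<close> but
  not on \<open>g\<close>, so it cancels pointwise.\<close>

lemma inj_on_shift_on: "inj_on (shift_on X V) (X \<rightarrow>\<^sub>E B)"
proof (rule inj_onI)
  fix g h assume g: "g \<in> X \<rightarrow>\<^sub>E B" and h: "h \<in> X \<rightarrow>\<^sub>E B" and eq: "shift_on X V g = shift_on X V h"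
  show "g = h"
  proof (rule PiE_ext[OF g h])
    fix x assume "x \<in> X"
    then show "g x = h x"
      using fun_cong[OF eq, of x] by (simp add: shift_on_def)
  qed
qed

text \<open>Whenever \<open>x\<close> is raised, \<open>up\<close> forces every element above it to
  be raised too, so no inequality \<open>g x \<le> g y\<close> is broken.\<close>

lemma shift_on_order_preserving:
  assumes g: "g \<in> order_preserving_maps X prec t"
    and up: "\<And>x y. x \<in> V \<Longrightarrow> y \<in> X \<Longrightarrow> prec x y \<Longrightarrow> y \<in> V"
  shows "shift_on X V g \<in> order_preserving_maps X prec (Suc t)"
proof -
  have "monotone_on X prec (\<le>) (shift_on X V g)"
  proof (rule monotone_onI)
    fix x y assume xy: "x \<in> X" "y \<in> X" "prec x y"
    then have "g x \<le> g y"
      using g by (auto simp: order_preserving_maps_def dest: monotone_onD)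
    then show "shift_on X V g x \<le> shift_on X V g y"
      using xy up[of x y] by (auto simp: shift_on_def)
  qed
  moreover have "shift_on X V g \<in> X \<rightarrow>\<^sub>E {1..Suc t}"
  proof
    fix x assume "x \<in> X"
    then have "g x \<in> {1..t}"
      using g by (auto simp: order_preserving_maps_def)
    with \<open>x \<in> X\<close> show "shift_on X V g x \<in> {1..Suc t}"
      by (cases "x \<in> V") (simp_all add: shift_on_def)
  qed (simp add: shift_on_def)
  ultimately show ?thesis
    by (simp add: order_preserving_maps_def)
qed

lemma up_closure_closed:
  assumes "strict_poset X prec" "S \<subseteq> X" "x \<in> up_closure X prec S" "y \<in> X" "prec x y"
  shows "y \<in> up_closure X prec S"
proof -
  obtain s where s: "s \<in> S" "s = x \<or> prec s x" and x: "x \<in> X"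
    using assms(3) by (auto simp: up_closure_def)
  have "transp_on X prec"
    using assms(1) by (simp add: strict_poset_def)
  moreover have "s \<in> X"
    using s(1) assms(2) by blast
  ultimately have "prec s y"
    using s(2) x assms(4,5) by (blast dest: transp_onD)
  then show ?thesis
    using s(1) assms(4) by (auto simp: up_closure_def)
qed

text \<open>An element of \<open>A - S\<close> could enter the closure only from strictly above some
  member of \<open>S\<close>, but both lie in one antichain. Hence \<open>S\<close> can be recovered
  from its closure, and the shift acts on \<open>A\<close> exactly as prescribed by
  \<open>S\<close>.\<close>

lemma antichain_Int_up_closure:
  assumes "antichain X prec A" "S \<subseteq> A" "a \<in> A"
  shows "a \<in> up_closure X prec S \<longleftrightarrow> a \<in> S"
proof
  assume "a \<in> up_closure X prec S"
  then obtain s where s: "s \<in> S" "s = a \<or> prec s a"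
    by (auto simp: up_closure_def)
  then have "\<not> prec s a" if "s \<noteq> a"
    using assms that by (auto simp: antichain_def dest: pairwiseD)
  then show "a \<in> S"
    using s by blast
next
  assume "a \<in> S"
  then show "a \<in> up_closure X prec S"
    using assms(1,3) by (auto simp: antichain_def up_closure_def)
qed

text \<open>Expanding a product of binomials picks \<open>p\<close> on a subset and \<open>q\<close>
  on the rest. It evaluates the total weight of both \<open>g\<close> and \<open>h\<close>.\<close>

lemma sum_Pow_prod:
  fixes p q :: "'a \<Rightarrow> 'b::comm_semiring_1"
  assumes "finite A" "\<And>a. a \<in> A \<Longrightarrow> p a + q a = c"
  shows "(\<Sum>S\<in>Pow A. (\<Prod>a\<in>S. p a) * (\<Prod>a\<in>A - S. q a)) = c ^ card A"
proof -
  have "(\<Sum>S\<in>Pow A. (\<Prod>a\<in>S. p a) * (\<Prod>a\<in>A - S. q a)) = (\<Prod>a\<in>A. p a + q a)"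
    by (rule prod_add[OF assms(1), symmetric])
  also have "\<dots> = c ^ card A"
    using assms by simp
  finally show ?thesis .
qed

text \<open>The cross-multiplied form of one step of the monotonicity, which keeps the whole count
  in the natural numbers.\<close>

lemma Omega_step:
  assumes fin: "finite X" and po: "strict_poset X prec" and A: "antichain X prec A"
  shows "Omega X prec t * Suc t ^ card A \<le> Omega X prec (Suc t) * t ^ card A"
proof -
  let ?M = "order_preserving_maps X prec"
  have AX: "A \<subseteq> X"
    using A by (simp add: antichain_def)
  have finA: "finite A"
    using AX fin by (rule finite_subset)
  have range: "1 \<le> g a \<and> g a \<le> n" if "g \<in> ?M n" "a \<in> A" for g n a
    using that AX by (auto simp: order_preserving_maps_def PiE_iff)
  define c where "c g S = (\<Prod>a\<in>S. g a) * (\<Prod>a\<in>A - S. Suc t - g a)" for g and S :: "'a set"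
  define d where "d h S = (\<Prod>a\<in>S. h a - 1) * (\<Prod>a\<in>A - S. Suc t - h a)" for h and S :: "'a set"
  \<comment> \<open>The comparison is made for one \<open>S\<close> at a time, since injectivity of
    the shift is available for a fixed set only; the sums are swapped below to match.\<close>
  have step: "(\<Sum>g\<in>?M t. c g S) \<le> (\<Sum>h\<in>?M (Suc t). d h S)" if "S \<in> Pow A" for S
  proof -
    let ?\<phi> = "shift_on X (up_closure X prec S)"
    have SA: "S \<subseteq> A"
      using that by simp
    have shift: "?\<phi> g a = g a + of_bool (a \<in> S)" if "a \<in> A" for g a
      using that AX antichain_Int_up_closure[OF A SA that] by (auto simp: shift_on_def)
    \<comment> \<open>On \<open>S\<close> the image exceeds \<open>g\<close> by 1, which
      \<open>d\<close> subtracts again; on \<open>A - S\<close> the two agree.\<close>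
    have "c g S = d (?\<phi> g) S" for g
    proof -
      have "(\<Prod>a\<in>S. g a) = (\<Prod>a\<in>S. ?\<phi> g a - 1)"
        using shift SA by (intro prod.cong) auto
      moreover have "(\<Prod>a\<in>A - S. Suc t - g a) = (\<Prod>a\<in>A - S. Suc t - ?\<phi> g a)"
        using shift by (intro prod.cong) auto
      ultimately show ?thesis
        by (simp add: c_def d_def)
    qed
    moreover have "inj_on ?\<phi> (?M t)"
      by (rule inj_on_subset[OF inj_on_shift_on]) (auto simp: order_preserving_maps_def)
    ultimately have "(\<Sum>g\<in>?M t. c g S) = (\<Sum>h\<in>?\<phi> ` ?M t. d h S)"
      by (simp add: sum.reindex)
    \<comment> \<open>The only loss in the estimate: maps outside the image contribute nonnegative
      weight.\<close>
    also have "\<dots> \<le> (\<Sum>h\<in>?M (Suc t). d h S)"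
    proof (rule sum_mono2)
      show "?\<phi> ` ?M t \<subseteq> ?M (Suc t)"
      proof (rule image_subsetI)
        fix g assume "g \<in> ?M t"
        then show "?\<phi> g \<in> ?M (Suc t)"
        proof (rule shift_on_order_preserving)
          show "y \<in> up_closure X prec S"
            if "x \<in> up_closure X prec S" "y \<in> X" "prec x y" for x y
            by (rule up_closure_closed[OF po subset_trans[OF SA AX] that])
        qed
      qed
    qed (simp_all add: finite_order_preserving_maps fin)
    finally show ?thesis .
  qed
  have "Omega X prec t * Suc t ^ card A = (\<Sum>g\<in>?M t. \<Sum>S\<in>Pow A. c g S)"
  proof -
    have "(\<Sum>S\<in>Pow A. c g S) = Suc t ^ card A" if "g \<in> ?M t" for g
      unfolding c_def
    proof (rule sum_Pow_prod[OF finA])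
      fix a assume "a \<in> A"
      then show "g a + (Suc t - g a) = Suc t"
        using range[OF that, of a] by simp
    qed
    then show ?thesis
      by (simp add: Omega_def)
  qed
  also have "\<dots> = (\<Sum>S\<in>Pow A. \<Sum>g\<in>?M t. c g S)"
    by (rule sum.swap)
  also have "\<dots> \<le> (\<Sum>S\<in>Pow A. \<Sum>h\<in>?M (Suc t). d h S)"
    by (rule sum_mono) (rule step)
  also have "\<dots> = (\<Sum>h\<in>?M (Suc t). \<Sum>S\<in>Pow A. d h S)"
    by (rule sum.swap)
  also have "\<dots> = (\<Sum>h\<in>?M (Suc t). t ^ card A)"
  proof (rule sum.cong[OF refl])
    fix h assume "h \<in> ?M (Suc t)"
    \<comment> \<open>Both truncated subtractions are exact because
      \<open>1 \<le> h a \<le> Suc t\<close>.\<close>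
    then have "h a - 1 + (Suc t - h a) = t" if "a \<in> A" for a
      using range[of h "Suc t" a] that by simp
    then show "(\<Sum>S\<in>Pow A. d h S) = t ^ card A"
      unfolding d_def by (rule sum_Pow_prod[OF finA])
  qed
  also have "\<dots> = Omega X prec (Suc t) * t ^ card A"
    by (simp add: Omega_def)
  finally show ?thesis .
qed

theorem theorem4p15:
  fixes X :: "'a set" and prec :: "'a \<Rightarrow> 'a \<Rightarrow> bool" and w :: nat
  assumes "finite X" and "strict_poset X prec" and "width X prec = w"
  shows "mono_on {1..} (\<lambda>t::nat. real (Omega X prec t) / real t ^ w)"
proof -
  let ?f = "\<lambda>t::nat. real (Omega X prec t) / real t ^ w"
  obtain A where A: "antichain X prec A" "card A = w"
    by (rule exists_antichain_card_width[OF assms(1), of prec]) (use assms(3) in simp)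
  have mono_Suc: "?f t \<le> ?f (Suc t)" if "1 \<le> t" for t
  proof -
    have "real (Omega X prec t * Suc t ^ w) \<le> real (Omega X prec (Suc t) * t ^ w)"
      using Omega_step[OF assms(1,2) A(1), of t] unfolding A(2) of_nat_le_iff .
    moreover have "0 < real t ^ w" "0 < real (Suc t) ^ w"
      using that by simp_all
    ultimately show ?thesis
      by (simp only: of_nat_mult of_nat_power pos_divide_le_eq pos_le_divide_eq times_divide_eq_left)
  qed
  show ?thesis
  proof (rule mono_onI)
    fix r s :: nat assume "r \<in> {1..}" "r \<le> s"
    from \<open>r \<le> s\<close> show "?f r \<le> ?f s"
    \<comment> \<open>Starting at \<open>r\<close> rather than 0 keeps \<open>n\<close> positive, as
      \<open>mono_Suc\<close> demands.\<close>
    proof (induction rule: dec_induct)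
      case (step n)
      then show ?case
        using \<open>r \<in> {1..}\<close> mono_Suc[of n] by (meson atLeast_iff order_trans)
    qed simp
  qed
qed

end
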